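(* Let $\alpha<1<\beta$ be real numbers, let $f\in\mathcal{A}$ belong to the class $\mathcal{S}(\alpha,\beta)$, and let $\gamma_n$ be the logarithmic coefficients of $f$. Then $$|\gamma_n|\leq \frac{\beta-\alpha}{n\pi}\left|\sin \frac{\pi(1-\alpha)}{\beta-\alpha}\right|\quad\text{for all integers } n\geq1.$$
   Context: $\Delta=\{z\in\mathbb{C}:|z|<1\}$ is the open unit disc. $\mathcal{A}$ is the class of functions $f$ analytic in $\Delta$ with $f(0)=0$ and $f'(0)=1$. For real $\alpha<1$ and $\beta>1$, $\mathcal{S}(\alpha,\beta)$ is the class of all $f\in\mathcal{A}$ such that $\alpha<\mathrm{Re}\{zf'(z)/f(z)\}<\beta$ for all $z\in\Delta$. Here $zf'(z)/f(z)$ is analytic in $\Delta$ with value $1$ at $z=0$; in particular $f(z)\neq0$ for $z\in\Delta\setminus\{0\}$. The logarithmic coefficients $\gamma_n=\gamma_n(f)$ ($n\ge1$) of such an $f$ are defined by $$\log\left\{\frac{f(z)}{z}\right\}=\sum_{n=1}^{\infty}2\gamma_n z^n\quad(z\in\Delta),$$ where $f(z)/z$ has value $1$ at $z=0$ and $\log\{f(z)/z\}$ is its analytic logarithm on $\Delta$ vanishing at $z=0$. *)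

theory Defs
  imports "HOL-Complex_Analysis.Complex_Analysis"
begin

definition class_A :: "(complex \<Rightarrow> complex) set" where
  "class_A = {f. f holomorphic_on ball 0 1 \<and> f 0 = 0 \<and> deriv f 0 = 1}"

text \<open>
  The value at \<open>0\<close> is that of the analytic continuation of \<open>z f'(z) / f(z)\<close> when \<open>f 0 = 0\<close> and
  \<open>f' 0 = 1\<close>; literal division would give \<open>0 / 0 = 0\<close>.
\<close>

definition log_deriv_quot :: "(complex \<Rightarrow> complex) \<Rightarrow> complex \<Rightarrow> complex" where
  "log_deriv_quot f z = (if z = 0 then 1 else z * deriv f z / f z)"

text \<open>
  The condition \<open>f z \<noteq> 0\<close> is implicit in the analyticity of \<open>z f'(z) / f(z)\<close>. It has to be
  spelled out because \<open>x / 0 = 0\<close>, so for \<open>\<alpha> < 0\<close> the inequalities alone would not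
  exclude zeros of \<open>f\<close>.
\<close>

definition class_S :: "real \<Rightarrow> real \<Rightarrow> (complex \<Rightarrow> complex) set" where
  "class_S \<alpha> \<beta> = {f \<in> class_A.
     (\<forall>z \<in> ball 0 1 - {0}. f z \<noteq> 0) \<and>
     (\<forall>z \<in> ball 0 1. \<alpha> < Re (log_deriv_quot f z) \<and> Re (log_deriv_quot f z) < \<beta>)}"

text \<open>
  \<open>g\<close> is the analytic branch of \<open>log (f z / z)\<close> with \<open>g 0 = 0\<close>. At \<open>z = 0\<close>, where \<open>f z / z\<close> is to be
  read as \<open>1\<close>, the exponential condition is implied by \<open>g 0 = 0\<close>.
\<close>

definition is_log_quot :: "(complex \<Rightarrow> complex) \<Rightarrow> (complex \<Rightarrow> complex) \<Rightarrow> bool" where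
  "is_log_quot f g \<longleftrightarrow> g holomorphic_on ball 0 1 \<and> g 0 = 0 \<and>
     (\<forall>z \<in> ball 0 1 - {0}. exp (g z) = f z / z)"

definition is_log_coeffs :: "(complex \<Rightarrow> complex) \<Rightarrow> (nat \<Rightarrow> complex) \<Rightarrow> bool" where
  "is_log_coeffs f \<gamma> \<longleftrightarrow> (\<exists>g. is_log_quot f g \<and>
     (\<forall>z \<in> ball 0 1. (\<lambda>n. 2 * \<gamma> (Suc n) * z ^ Suc n) sums g z))"

text \<open>
  Only the coefficients with index \<open>n \<ge> 1\<close> are meaningful; index \<open>0\<close> is set to \<open>0\<close> to make
  the sequence unique.
\<close>

definition log_coeff :: "(complex \<Rightarrow> complex) \<Rightarrow> nat \<Rightarrow> complex" where
  "log_coeff f = (THE \<gamma>. \<gamma> 0 = 0 \<and> is_log_coeffs f \<gamma>)"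

lemma is_log_quot_unique:
  assumes "is_log_quot f g1" "is_log_quot f g2" "z \<in> ball 0 1"
  shows "g1 z = g2 z"
proof -
  define d where "d = (\<lambda>z. g1 z - g2 z)"
  have hol: "d holomorphic_on ball 0 1"
    using assms unfolding d_def is_log_quot_def by (intro holomorphic_intros) auto
  have e1: "exp (d w) = 1" if "w \<in> ball 0 1" for w
  proof (cases "w = 0")
    case False
    then have "exp (g1 w) = exp (g2 w)"
      using assms(1,2) that by (auto simp: is_log_quot_def)
    then show ?thesis by (simp add: d_def exp_diff)
  qed (use assms in \<open>auto simp: d_def is_log_quot_def\<close>)
  have der: "(d has_field_derivative 0) (at w within ball 0 1)" if w: "w \<in> ball 0 1" for w
  proof -
    have D: "(d has_field_derivative deriv d w) (at w)"
      using hol w by (intro holomorphic_derivI[where S = "ball 0 1"]) auto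
    then have "((\<lambda>w. exp (d w)) has_field_derivative exp (d w) * deriv d w) (at w)"
      by (auto intro!: derivative_eq_intros)
    moreover have "((\<lambda>w. exp (d w)) has_field_derivative 0) (at w)"
      by (rule has_field_derivative_transform_within_open[where f = "\<lambda>_. 1" and S = "ball 0 1"])
         (use w e1 in auto)
    ultimately have "exp (d w) * deriv d w = 0" by (rule DERIV_unique)
    then have "deriv d w = 0" by simp
    with D show ?thesis by (metis has_field_derivative_at_within)
  qed
  obtain c where c: "\<And>w. w \<in> ball 0 1 \<Longrightarrow> d w = c"
    using has_field_derivative_zero_constant[OF convex_ball der] by metis
  have "d z = d 0" using c assms(3) by simp
  then show ?thesis using assms(1,2) by (simp add: d_def is_log_quot_def)
qed

lemma is_log_quot_exists:
  assumes "f \<in> class_A" and nz: "\<And>z. z \<in> ball 0 1 - {0} \<Longrightarrow> f z \<noteq> 0"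
  shows "\<exists>g. is_log_quot f g"
proof -
  have f: "f holomorphic_on ball 0 1" "f 0 = 0" "deriv f 0 = 1"
    using assms(1) by (auto simp: class_A_def)
  define h where "h = (\<lambda>z. if z = 0 then deriv f 0 else (f z - f 0) / (z - 0))"
  have h: "h holomorphic_on ball 0 1"
    unfolding h_def by (rule pole_lemma) (use f in auto)
  have hnz: "\<And>z. z \<in> ball 0 1 \<Longrightarrow> h z \<noteq> 0" using f nz by (auto simp: h_def)
  obtain g where g: "g holomorphic_on ball 0 1" "\<And>z. z \<in> ball 0 1 \<Longrightarrow> h z = exp (g z)"
    using contractible_imp_holomorphic_log[OF h convex_imp_contractible hnz]
    by (metis convex_ball)
  have e0: "exp (g 0) = 1" using g(2)[of 0] f by (simp add: h_def)
  have "is_log_quot f (\<lambda>z. g z - g 0)"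
    using g(1) g(2)[symmetric] e0 f unfolding is_log_quot_def
    by (auto intro!: holomorphic_intros simp: exp_diff h_def)
  then show ?thesis by blast
qed

lemma log_coeffs_ex1:
  assumes "f \<in> class_A" and "\<And>z. z \<in> ball 0 1 - {0} \<Longrightarrow> f z \<noteq> 0"
  shows "\<exists>!\<gamma>. \<gamma> 0 = 0 \<and> is_log_coeffs f \<gamma>"
proof -
  obtain g where g: "is_log_quot f g" using is_log_quot_exists[OF assms] by blast
  define c where "c = (\<lambda>n. (deriv ^^ n) g 0 / fact n)"
  have ser: "(\<lambda>n. c n * z ^ n) sums g z" if "z \<in> ball 0 1" for z
    using holomorphic_power_series[of g 0 1 z] g that by (simp add: c_def is_log_quot_def)
  have c0: "c 0 = 0" using g by (simp add: c_def is_log_quot_def)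
  have "(\<lambda>n. 2 * (c (Suc n) / 2) * z ^ Suc n) sums g z" if "z \<in> ball 0 1" for z
    using ser[OF that] sums_Suc_iff[of "\<lambda>n. c n * z ^ n" "g z"] c0 by simp
  then have ex: "is_log_coeffs f (\<lambda>n. c n / 2)"
    using g unfolding is_log_coeffs_def by blast
  have un: "\<gamma> n = c n / 2" if \<gamma>: "\<gamma> 0 = 0" "is_log_coeffs f \<gamma>" for \<gamma> n
  proof -
    obtain g' where g': "is_log_quot f g'"
      "\<And>z. z \<in> ball 0 1 \<Longrightarrow> (\<lambda>n. 2 * \<gamma> (Suc n) * z ^ Suc n) sums g' z"
      using \<gamma>(2) unfolding is_log_coeffs_def by blast
    have "(\<lambda>n. (2 * \<gamma> n) * z ^ n) sums g z" if "z \<in> ball 0 1" for z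
      using g'(2)[OF that] is_log_quot_unique[OF g g'(1) that] \<gamma>(1)
        sums_Suc_iff[of "\<lambda>n. (2 * \<gamma> n) * z ^ n" "g z"] by simp
    then have z: "(\<lambda>n. (2 * \<gamma> n - c n) * z ^ n) sums 0" if "z \<in> ball 0 1" for z
      using sums_diff[OF _ ser[OF that]] that by (fastforce simp: algebra_simps)
    have "2 * \<gamma> n - c n = 0"
    proof (rule ccontr)
      assume nz: "2 * \<gamma> n - c n \<noteq> 0"
      with c0 \<gamma>(1) have "n > 0" by (cases n) auto
      have S: "(\<lambda>n. (2 * \<gamma> n - c n) * (x - 0) ^ n) sums (\<lambda>_. 0) x"
        if "norm (x - 0) < 1" for x
        using z[of x] that by simp
      show False
      proof (rule powser_0_nonzero[OF zero_less_one S refl nz \<open>n > 0\<close>])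
        fix s :: real
        assume "0 < s" and ne: "\<And>z::complex. z \<in> cball 0 s - {0} \<Longrightarrow> (0::complex) \<noteq> 0"
        with ne[of "of_real s"] show False by simp
      qed
    qed
    then show ?thesis by (simp add: field_simps)
  qed
  show ?thesis using ex c0 un by (intro ex1I[of _ "\<lambda>n. c n / 2"]) auto
qed

lemma is_log_coeffs_log_coeff:
  assumes "f \<in> class_S \<alpha> \<beta>"
  shows "is_log_coeffs f (log_coeff f)"
  using theI'[OF log_coeffs_ex1, of f] assms unfolding log_coeff_def class_S_def by auto

end

theory Submission
  imports Defs
begin

text \<open>
  The estimate is Rogosinski's coefficient bound for functions subordinate to a convex one, applied to a
  strip. Write \<open>p z = z f'(z) / f z = 1 + z g'(z)\<close> with \<open>g\<close> the logarithm of \<open>f z / z\<close>; the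
  \<open>n\<close>-th coefficient of \<open>p\<close> is \<open>2 n \<gamma>\<^sub>n\<close>. Averaging \<open>p\<close> over the rotations by \<open>n\<close>-th roots of unity
  gives \<open>q (z\<^sup>n)\<close> with \<open>q\<close> analytic and \<open>q'(0) = 2 n \<gamma>\<^sub>n\<close>. As the strip \<open>\<alpha> < Re w < \<beta>\<close> is convex,
  \<open>q\<close> takes its values there, so the Schwarz lemma for the strip bounds \<open>q'(0)\<close>.
\<close>

lemma sum_powers_root_of_unity:
  fixes n m :: nat
  assumes "n \<ge> 1"
  shows "(\<Sum>k<n. exp (2 * of_real pi * \<i> * of_nat k / of_nat n) ^ m) = (if n dvd m then of_nat n else 0)"
proof -
  \<comment> \<open>Exchanging the roles of \<open>k\<close> and \<open>m\<close> makes the sum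
    geometric with ratio \<open>x\<close>; since \<open>x ^ n = 1\<close>, it vanishes unless
    \<open>x = 1\<close>.\<close>
  define x where "x = exp (2 * of_real pi * \<i> * of_nat m / of_nat n)"
  have "(\<Sum>k<n. exp (2 * of_real pi * \<i> * of_nat k / of_nat n) ^ m) = (\<Sum>k<n. x ^ k)"
    unfolding x_def by (intro sum.cong refl) (simp add: exp_of_nat_mult [symmetric] mult_ac)
  moreover have "x = 1 \<longleftrightarrow> n dvd m"
    unfolding x_def by (rule complex_root_unity_eq_1) fact
  moreover have "x ^ n = 1"
    unfolding x_def by (rule complex_root_unity) (use assms in simp)
  ultimately show ?thesis by (auto simp: geometric_sum)
qed

lemma nth_root_in_unit_ball:
  fixes w :: complex
  assumes "n \<ge> 1" "norm w < 1"
  obtains z where "norm z < 1" "z ^ n = w"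
proof -
  obtain z where z: "z ^ n = w"
  proof (cases "w = 0")
    case True
    with assms(1) that[of 0] show thesis by simp
  next
    case False
    with assms(1) have "exp (Ln w / of_nat n) ^ n = w"
      by (simp add: exp_of_nat_mult [symmetric])
    with that show thesis .
  qed
  then have "norm z ^ n < 1" using assms(2) by (simp add: norm_power [symmetric])
  then have "norm z < 1" by (meson linorder_not_le one_le_power)
  with z that show thesis by blast
qed

text \<open>For \<open>w = z ^ n\<close>, the mean of \<open>p\<close> over the points
  \<open>e k * z\<close> is a convex combination of points of \<open>C\<close>, and the roots of
  unity cancel every power whose exponent is not a multiple of \<open>n\<close>. The series
  determines \<open>q w\<close>, so the choice of the root \<open>z\<close> does not matter and
  \<open>q\<close> can be chosen pointwise.\<close>

lemma every_nth_coeff_convex_range: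
  fixes p :: "complex \<Rightarrow> complex"
  assumes ser: "\<And>z. norm z < 1 \<Longrightarrow> (\<lambda>m. a m * z ^ m) sums p z"
    and p: "\<And>z. norm z < 1 \<Longrightarrow> p z \<in> C" and C: "convex C" and n: "n \<ge> 1"
  obtains q where "\<And>w. norm w < 1 \<Longrightarrow> q w \<in> C" "\<And>w. norm w < 1 \<Longrightarrow> (\<lambda>k. a (n * k) * w ^ k) sums q w"
proof -
  define e where "e = (\<lambda>k. exp (2 * of_real pi * \<i> * of_nat k / of_nat n))"
  have ne: "norm (e k) = 1" for k by (simp add: e_def)
  have "\<exists>v\<in>C. (\<lambda>k. a (n * k) * w ^ k) sums v" if w: "norm w < 1" for w
  proof -
    obtain z where z: "norm z < 1" "z ^ n = w" using nth_root_in_unit_ball[OF n w] .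
    define v where "v = (\<Sum>k<n. (1 / real n) *\<^sub>R p (e k * z))"
    have ez: "norm (e k * z) < 1" for k using z ne by (simp add: norm_mult)
    have "v \<in> C" unfolding v_def
      by (rule convex_sum) (use n C p ez in auto)
    moreover have "(\<lambda>m. \<Sum>k<n. (1 / real n) *\<^sub>R (a m * (e k * z) ^ m)) sums v"
      unfolding v_def by (intro sums_sum sums_scaleR_right ser ez)
    moreover have "(\<Sum>k<n. (1 / real n) *\<^sub>R (a m * (e k * z) ^ m)) = (if n dvd m then a m * z ^ m else 0)" for m
    proof -
      have "(\<Sum>k<n. (1 / real n) *\<^sub>R (a m * (e k * z) ^ m)) = (1 / real n) *\<^sub>R (a m * z ^ m * (\<Sum>k<n. e k ^ m))"
        by (simp add: sum_distrib_left scaleR_sum_right power_mult_distrib mult_ac)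
      also have "(\<Sum>k<n. e k ^ m) = (if n dvd m then of_nat n else 0)"
        unfolding e_def by (rule sum_powers_root_of_unity[OF n])
      finally show ?thesis using n by (auto simp: scaleR_conv_of_real)
    qed
    ultimately have "(\<lambda>m. if n dvd m then a m * z ^ m else 0) sums v" by simp
    \<comment> \<open>All terms outside the range of this map are zero, so reindexing along it keeps
      the sum.\<close>
    moreover have "strict_mono (\<lambda>k. n * k)" using n by (auto intro: strict_monoI)
    ultimately have "(\<lambda>k. if n dvd n * k then a (n * k) * z ^ (n * k) else 0) sums v"
      by (subst sums_mono_reindex) auto
    then have "(\<lambda>k. a (n * k) * w ^ k) sums v" using z(2) by (simp add: power_mult)
    with \<open>v \<in> C\<close> show ?thesis by blast
  qed
  then show thesis using that by metis
qed

text \<open>The squares of the two sides differ by \<open>4 * Im z * Im w\<close>: a point of the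
  upper half-plane is closer to \<open>w\<close> than to its mirror image in the real axis.\<close>

lemma norm_diff_cnj_less:
  assumes "Im z > 0" "Im w > 0"
  shows "norm (z - w) < norm (z - cnj w)"
proof -
  have "0 < Im z * Im w" using assms by simp
  then have "(norm (z - w))\<^sup>2 < (norm (z - cnj w))\<^sup>2"
    unfolding cmod_power2 by (simp add: power2_eq_square algebra_simps)
  then show ?thesis by (rule power2_less_imp_less) simp
qed

text \<open>The Cayley transform centred at \<open>h 0\<close> takes the upper half-plane to the
  unit disc and \<open>h 0\<close> to the origin, so the Schwarz lemma applies to
  \<open>W\<close>.\<close>

lemma Schwarz_half_plane:
  assumes hol: "h holomorphic_on ball 0 1" and im: "\<And>z. norm z < 1 \<Longrightarrow> Im (h z) > 0"
  shows "norm (deriv h 0) \<le> 2 * Im (h 0)"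
proof -
  define W where "W = (\<lambda>z. (h z - h 0) / (h z - cnj (h 0)))"
  have lt: "norm (h z - h 0) < norm (h z - cnj (h 0))" if "norm z < 1" for z
    using norm_diff_cnj_less im that by simp
  then have nz: "h z - cnj (h 0) \<noteq> 0" if "norm z < 1" for z
    using that by fastforce
  have "norm (deriv W 0) \<le> 1"
  proof (rule Schwarz_Lemma(2)[where \<xi> = 0])
    show "W holomorphic_on ball 0 1"
      unfolding W_def using hol nz by (auto intro!: holomorphic_intros)
    show "norm (W z) < 1" if "norm z < 1" for z
      using lt[OF that] nz[OF that] by (simp add: W_def norm_divide)
  qed (auto simp: W_def)
  \<comment> \<open>The numerator of \<open>W\<close> vanishes at 0, which leaves one term of the
    quotient rule.\<close>
  moreover have "deriv W 0 = deriv h 0 / (h 0 - cnj (h 0))"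
  proof (rule DERIV_imp_deriv)
    have "(h has_field_derivative deriv h 0) (at 0)"
      using holomorphic_derivI[OF hol] by simp
    then show "(W has_field_derivative deriv h 0 / (h 0 - cnj (h 0))) (at 0)"
      unfolding W_def using nz[of 0] by (auto intro!: derivative_eq_intros)
  qed
  moreover have "h 0 - cnj (h 0) = 2 * of_real (Im (h 0)) * \<i>"
    by (simp add: complex_eq_iff)
  ultimately show ?thesis using im[of 0] by (simp add: norm_divide norm_mult divide_le_eq)
qed

text \<open>The map sending \<open>w\<close> to \<open>exp (\<i> * s * (w - \<alpha>))\<close> opens
  the strip onto the upper half-plane: the argument \<open>s * (Re w - \<alpha>)\<close> runs
  through the interval from 0 to \<open>pi\<close>.\<close>

lemma Schwarz_strip:
  fixes \<alpha> \<beta> :: real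
  assumes hol: "q holomorphic_on ball 0 1"
    and re: "\<And>z. norm z < 1 \<Longrightarrow> \<alpha> < Re (q z) \<and> Re (q z) < \<beta>"
  shows "norm (deriv q 0) \<le> 2 * (\<beta> - \<alpha>) / pi * sin (pi * (Re (q 0) - \<alpha>) / (\<beta> - \<alpha>))"
proof -
  define s where "s = pi / (\<beta> - \<alpha>)"
  have "\<alpha> < \<beta>" using re[of 0] by simp
  then have s: "s > 0" by (simp add: s_def)
  define h where "h = (\<lambda>z. exp (\<i> * of_real s * (q z - of_real \<alpha>)))"
  have Im_h: "Im (h z) = exp (- s * Im (q z)) * sin (s * (Re (q z) - \<alpha>))" for z
    by (simp add: h_def Im_exp)
  have "norm (deriv h 0) \<le> 2 * Im (h 0)"
  proof (rule Schwarz_half_plane)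
    show "h holomorphic_on ball 0 1"
      unfolding h_def using hol by (intro holomorphic_intros)
    show "Im (h z) > 0" if "norm z < 1" for z
    proof -
      have "0 < s * (Re (q z) - \<alpha>)" using re[OF that] s by simp
      moreover have "s * (Re (q z) - \<alpha>) < s * (\<beta> - \<alpha>)"
        using re[OF that] s by (intro mult_strict_left_mono) auto
      moreover have "s * (\<beta> - \<alpha>) = pi" using \<open>\<alpha> < \<beta>\<close> by (simp add: s_def)
      ultimately show ?thesis by (simp add: Im_h sin_gt_zero)
    qed
  qed
  moreover have "deriv h 0 = h 0 * (\<i> * of_real s * deriv q 0)"
  proof (rule DERIV_imp_deriv)
    have "(q has_field_derivative deriv q 0) (at 0)"
      using holomorphic_derivI[OF hol] by simp
    then show "(h has_field_derivative h 0 * (\<i> * of_real s * deriv q 0)) (at 0)"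
      unfolding h_def by (auto intro!: derivative_eq_intros)
  qed
  \<comment> \<open>This positive factor occurs in both \<open>norm (deriv h 0)\<close> and
    \<open>Im (h 0)\<close>, so it cancels and the bound depends on \<open>Re (q 0)\<close>
    alone.\<close>
  moreover have "norm (h 0) = exp (- s * Im (q 0))" by (simp add: h_def)
  ultimately have "s * norm (deriv q 0) \<le> 2 * sin (s * (Re (q 0) - \<alpha>))"
    using s by (simp add: Im_h norm_mult)
  then have "norm (deriv q 0) \<le> 2 / s * sin (s * (Re (q 0) - \<alpha>))"
    using s by (simp add: field_simps)
  then show ?thesis by (simp add: s_def)
qed

lemma coeff_bound_strip:
  fixes \<alpha> \<beta> :: real
  assumes ser: "\<And>z. norm z < 1 \<Longrightarrow> (\<lambda>m. a m * z ^ m) sums p z"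
    and re: "\<And>z. norm z < 1 \<Longrightarrow> \<alpha> < Re (p z) \<and> Re (p z) < \<beta>" and n: "n \<ge> 1"
  shows "norm (a n) \<le> 2 * (\<beta> - \<alpha>) / pi * sin (pi * (Re (a 0) - \<alpha>) / (\<beta> - \<alpha>))"
proof -
  define C where "C = {w. \<alpha> < Re w} \<inter> {w. Re w < \<beta>}"
  have "convex C"
    unfolding C_def by (intro convex_Int convex_halfspace_Re_gt convex_halfspace_Re_lt)
  moreover have "p z \<in> C" if "norm z < 1" for z using re[OF that] by (simp add: C_def)
  ultimately obtain q where qC: "\<And>w. norm w < 1 \<Longrightarrow> q w \<in> C"
    and q: "\<And>w. norm w < 1 \<Longrightarrow> (\<lambda>k. a (n * k) * w ^ k) sums q w"
    using every_nth_coeff_convex_range[OF ser _ _ n] by metis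
  have hol: "q holomorphic_on ball 0 1"
    by (rule power_series_holomorphic[where a = "\<lambda>k. a (n * k)"]) (use q in simp)
  \<comment> \<open>At 0 only the term \<open>k = 0\<close> of the differentiated series survives,
    with coefficient \<open>a (n * 1)\<close>.\<close>
  have "(\<lambda>k. diffs (\<lambda>k. a (n * k)) k * 0 ^ k) sums deriv q 0"
    by (rule termdiffs_sums_strong[OF q]) (use holomorphic_derivI[OF hol] in auto)
  then have d: "deriv q 0 = a n"
    using powser_sums_zero_iff by (fastforce simp: diffs_def)
  have q0: "q 0 = a 0"
    using q[of 0] powser_sums_zero_iff by fastforce
  show ?thesis
    using Schwarz_strip[OF hol, of \<alpha> \<beta>] qC by (simp add: d q0 C_def)
qed

text \<open>Away from 0 this is the product rule for \<open>f z = z * exp (g z)\<close>; at 0 both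
  sides are 1, by the value built into \<open>log_deriv_quot\<close>.\<close>

lemma deriv_log_quot:
  assumes g: "is_log_quot f g" and f: "f holomorphic_on ball 0 1" and z: "norm z < 1"
  shows "log_deriv_quot f z = 1 + z * deriv g z"
proof (cases "z = 0")
  case False
  have gh: "g holomorphic_on ball 0 1" and e: "\<And>z. z \<in> ball 0 1 - {0} \<Longrightarrow> f z = z * exp (g z)"
    using g by (auto simp: is_log_quot_def)
  have "(f has_field_derivative deriv f z) (at z)"
    using holomorphic_derivI[OF f] z by simp
  moreover have "(f has_field_derivative exp (g z) * (1 + z * deriv g z)) (at z)"
  proof (rule has_field_derivative_transform_within_open)
    have "(g has_field_derivative deriv g z) (at z)"
      using holomorphic_derivI[OF gh] z by simp
    then show "((\<lambda>z. z * exp (g z)) has_field_derivative exp (g z) * (1 + z * deriv g z)) (at z)"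
      by (auto intro!: derivative_eq_intros simp: algebra_simps)
    show "open (ball 0 1 - {0 :: complex})" by (simp add: open_Diff)
    show "z * exp (g z) = f z" if "z \<in> ball 0 1 - {0}" for z using e[OF that] by simp
  qed (use z False in auto)
  ultimately have "deriv f z = exp (g z) * (1 + z * deriv g z)" by (rule DERIV_unique)
  with e[of z] z False show ?thesis by (simp add: log_deriv_quot_def)
qed (simp add: log_deriv_quot_def)

lemma log_deriv_quot_power_series:
  assumes \<gamma>: "is_log_coeffs f \<gamma>" and f: "f holomorphic_on ball 0 1" and z: "norm z < 1"
  shows "(\<lambda>n. (if n = 0 then 1 else 2 * of_nat n * \<gamma> n) * z ^ n) sums log_deriv_quot f z"
proof -
  obtain g where g: "is_log_quot f g"
    and ser: "\<And>z. z \<in> ball 0 1 \<Longrightarrow> (\<lambda>n. 2 * \<gamma> (Suc n) * z ^ Suc n) sums g z"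
    using \<gamma> unfolding is_log_coeffs_def by blast
  have gh: "g holomorphic_on ball 0 1" using g by (simp add: is_log_quot_def)
  \<comment> \<open>\<open>is_log_coeffs\<close> leaves \<open>\<gamma> 0\<close> free, whereas the
    constant term of the series of \<open>g\<close> must be 0.\<close>
  define c where "c = (\<lambda>n. if n = 0 then 0 else 2 * \<gamma> n)"
  have "(\<lambda>n. c n * z ^ n) sums g z" if "norm z < 1" for z
    using ser[of z] that sums_Suc_iff[of "\<lambda>n. c n * z ^ n" "g z"] by (simp add: c_def)
  then have "(\<lambda>n. diffs c n * z ^ n) sums deriv g z"
    by (rule termdiffs_sums_strong) (use z holomorphic_derivI[OF gh] in auto)
  then have "(\<lambda>n. z * (diffs c n * z ^ n)) sums (z * deriv g z)" by (rule sums_mult)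
  then have "(\<lambda>n. (2 * of_nat (Suc n) * \<gamma> (Suc n)) * z ^ Suc n) sums (z * deriv g z)"
    by (simp add: diffs_def c_def algebra_simps)
  then show ?thesis
    using sums_Suc_iff[of "\<lambda>n. (if n = 0 then 1 else 2 * of_nat n * \<gamma> n) * z ^ n" "z * deriv g z"]
    by (simp add: deriv_log_quot[OF g f z] add.commute)
qed

theorem theorem2p3:
  fixes \<alpha> \<beta> :: real and f :: "complex \<Rightarrow> complex"
  assumes "\<alpha> < 1" and "1 < \<beta>" and "f \<in> class_S \<alpha> \<beta>"
  shows "\<forall>n::nat. n \<ge> 1 \<longrightarrow>
    norm (log_coeff f n) \<le>
      (\<beta> - \<alpha>) / (real n * pi) * \<bar>sin (pi * (1 - \<alpha>) / (\<beta> - \<alpha>))\<bar>"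
proof (intro allI impI)
  fix n :: nat
  assume n: "n \<ge> 1"
  define a where "a = (\<lambda>m. if m = 0 then 1 else 2 * of_nat m * log_coeff f m)"
  let ?s = "sin (pi * (1 - \<alpha>) / (\<beta> - \<alpha>))"
  have f: "f holomorphic_on ball 0 1" using assms(3) by (simp add: class_S_def class_A_def)
  have "norm (a n) \<le> 2 * (\<beta> - \<alpha>) / pi * sin (pi * (Re (a 0) - \<alpha>) / (\<beta> - \<alpha>))"
  proof (rule coeff_bound_strip)
    show "(\<lambda>m. a m * z ^ m) sums log_deriv_quot f z" if "norm z < 1" for z
      unfolding a_def
      by (rule log_deriv_quot_power_series[OF is_log_coeffs_log_coeff[OF assms(3)] f that])
    show "\<alpha> < Re (log_deriv_quot f z) \<and> Re (log_deriv_quot f z) < \<beta>" if "norm z < 1" for z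
      using assms(3) that by (simp add: class_S_def)
  qed fact
  \<comment> \<open>Since \<open>a 0 = 1\<close>, the sine is already \<open>?s\<close>, and only
    the absolute value is inserted.\<close>
  also have "\<dots> \<le> 2 * (\<beta> - \<alpha>) / pi * \<bar>?s\<bar>"
    using assms(1,2) by (intro mult_left_mono) (auto simp: a_def)
  finally have "2 * real n * norm (log_coeff f n) \<le> 2 * (\<beta> - \<alpha>) / pi * \<bar>?s\<bar>"
    using n by (simp add: a_def norm_mult)
  then show "norm (log_coeff f n) \<le> (\<beta> - \<alpha>) / (real n * pi) * \<bar>?s\<bar>"
    using n by (simp add: field_simps)
qed

end
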